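(* Let $\mathbb{F}$ be a field, let $G$ be a finite group and let $X$ be a finite $G$-set. For any subgroup $H$ of $G$, $$\dim(L^H(X))=\frac{1}{|H|}\sum_{a\in H}|\mathrm{Fix}\,a|,$$ where $\mathrm{Fix}\,a=\{x\in X\colon a\cdot x=x\}$.
   Context: A $G$-set is a nonempty set $X$ with an action of the group $G$, written $a\cdot x$. $L(X)$ denotes the $\mathbb{F}$-vector space of all functions from $X$ to $\mathbb{F}$ with pointwise operations. For a subgroup $H$ of $G$, acting on $X$ by restriction of the $G$-action, $L^H(X)=\{f\in L(X)\colon f(a\cdot x)=f(x)\text{ for all }a\in H, x\in X\}$, a subspace of $L(X)$. Dimension is over $\mathbb{F}$. (The dimension formula is an equality of natural/rational numbers, not an equality in $\mathbb{F}$.) *)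

theory Defs
  imports Complex_Main "HOL-Algebra.Group_Action" "HOL-Library.Function_Algebras"
begin

definition scale_fun :: "'f::field \<Rightarrow> ('x \<Rightarrow> 'f) \<Rightarrow> 'x \<Rightarrow> 'f"
  where "scale_fun c f = (\<lambda>x. c * f x)"

interpretation fun_space: vector_space scale_fun
  by unfold_locales (auto simp: scale_fun_def fun_eq_iff algebra_simps)

text \<open>
  HOL functions are total on their type, so a function \<open>X \<rightarrow> \<bbbF>\<close> on a set \<open>X\<close> is represented by
  its extension by zero. This gives a linear copy of the space of functions on \<open>X\<close>, with the
  pointwise operations, inside the space of all functions on the type.
\<close>

definition L :: "'x set \<Rightarrow> ('x \<Rightarrow> 'f::field) set"
  where "L X = {f. \<forall>x. x \<notin> X \<longrightarrow> f x = 0}"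

definition L_inv :: "'g set \<Rightarrow> ('g \<Rightarrow> 'x \<Rightarrow> 'x) \<Rightarrow> 'x set \<Rightarrow> ('x \<Rightarrow> 'f::field) set"
  where "L_inv H \<phi> X = {f \<in> L X. \<forall>a\<in>H. \<forall>x\<in>X. f (\<phi> a x) = f x}"

lemma subspace_L: "fun_space.subspace (L X)"
  by (auto simp: fun_space.subspace_def L_def scale_fun_def)

lemma subspace_L_inv: "fun_space.subspace (L_inv H \<phi> X)"
  by (auto simp: fun_space.subspace_def L_def L_inv_def scale_fun_def)

end

theory Submission
  imports Defs "HOL-Library.Disjoint_Sets" "HOL-Library.Indicator_Function"
begin

text \<open>
  A function in \<open>L X\<close> is \<open>H\<close>-invariant iff it is constant on each \<open>H\<close>-orbit, so the indicator
  functions of the orbits form a basis of the invariant functions. This works over every field, as no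
  averaging over \<open>H\<close> is involved. The number of orbits is given by Burnside's lemma.
\<close>

lemma sum_fun_apply: "(\<Sum>i\<in>I. f i) x = (\<Sum>i\<in>I. f i x)"
  by (induction I rule: infinite_finite_induct) auto

lemma inj_indicator: "inj (indicator :: 'a set \<Rightarrow> 'a \<Rightarrow> 'b::zero_neq_one)"
  by (auto simp: inj_on_def fun_eq_iff indicator_def)

text \<open>By disjointness \<open>A\<close> is the only member of \<open>P\<close> that contains
  \<open>x\<close>, so all other terms vanish there. Evaluation at a point thus reads off a single
  coefficient; both independence and spanning rest on this.\<close>

lemma sum_scaled_indicators_apply:
  fixes c :: "'x set \<Rightarrow> 'f::field"
  assumes "disjoint P" "finite P" "A \<in> P" "x \<in> A"
  shows "(\<Sum>B\<in>P. scale_fun (c B) (indicator B)) x = c A"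
proof -
  have "x \<notin> B" if "B \<in> P" "B \<noteq> A" for B
    using assms that by (auto simp: disjoint_def)
  then have "(\<Sum>B\<in>P. scale_fun (c B) (indicator B) x) = (\<Sum>B\<in>P. if B = A then c B else 0)"
    using assms by (intro sum.cong) (auto simp: scale_fun_def)
  then show ?thesis
    using assms by (simp add: sum_fun_apply)
qed

text \<open>Evaluating a vanishing combination at a point of \<open>A\<close> isolates the
  coefficient of \<open>indicator A\<close>; since no member of \<open>P\<close> is empty, such a
  point exists.\<close>

lemma independent_indicators:
  assumes "disjoint P" "finite P" "{} \<notin> P"
  shows "fun_space.independent (indicator ` P :: ('x \<Rightarrow> 'f::field) set)"
proof (rule fun_space.independent_if_scalars_zero)
  show "finite (indicator ` P :: ('x \<Rightarrow> 'f) set)"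
    using assms by simp
next
  fix u :: "('x \<Rightarrow> 'f) \<Rightarrow> 'f" and f :: "'x \<Rightarrow> 'f"
  assume sum0: "(\<Sum>f\<in>indicator ` P. scale_fun (u f) f) = 0" and "f \<in> indicator ` P"
  then obtain A where A: "A \<in> P" "f = indicator A"
    by auto
  with assms obtain x where "x \<in> A"
    by fastforce
  \<comment> \<open>The scalars \<open>u\<close> are indexed by functions. Distinct sets have
    distinct indicators, so the sum can be reindexed by the sets themselves.\<close>
  have "(\<Sum>B\<in>P. scale_fun (u (indicator B)) (indicator B)) = (0 :: 'x \<Rightarrow> 'f)"
    using sum0 by (simp add: sum.reindex inj_on_subset[OF inj_indicator])
  then show "u f = 0"
    using sum_scaled_indicators_apply[OF assms(1,2) A(1) \<open>x \<in> A\<close>, of "\<lambda>B. u (indicator B)"] A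
    by simp
qed

text \<open>The linear algebra is separated from the group action here: for any finite partition,
  the indicators of the parts form a basis, and the coordinates of \<open>f\<close> are its values
  on the parts.\<close>

lemma dim_constant_on_parts:
  assumes P: "partition_on X P" and "finite P"
  shows "fun_space.dim {f \<in> L X :: ('x \<Rightarrow> 'f::field) set. \<forall>A\<in>P. \<forall>x\<in>A. \<forall>y\<in>A. f x = f y} = card P"
    (is "fun_space.dim ?V = _")
proof -
  note parts = partition_onD1[OF P] partition_onD2[OF P] partition_onD3[OF P]
  let ?B = "indicator ` P :: ('x \<Rightarrow> 'f) set"
  have "?B \<subseteq> ?V"
  proof (rule image_subsetI)
    fix A assume A: "A \<in> P"
    have "(indicator A x :: 'f) = indicator A y" if C: "C \<in> P" "x \<in> C" "y \<in> C" for C x y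
    proof -
      have "C = A \<or> C \<inter> A = {}"
        using parts(2) A C(1) by (meson disjointD)
      then have "x \<in> A \<longleftrightarrow> y \<in> A"
        using C by blast
      then show ?thesis
        by (simp add: indicator_def)
    qed
    moreover have "indicator A \<in> (L X :: ('x \<Rightarrow> 'f) set)"
      using A parts(1) by (auto simp: L_def indicator_def)
    ultimately show "indicator A \<in> ?V"
      by blast
  qed
  moreover have "?V \<subseteq> fun_space.span ?B"
  proof
    fix f assume f: "f \<in> ?V"
    \<comment> \<open>\<open>SOME\<close> picks a representative of each part; the choice is
      immaterial because \<open>f\<close> is constant on the part.\<close>
    have "f = (\<Sum>A\<in>P. scale_fun (f (SOME x. x \<in> A)) (indicator A))"
    proof
      fix x
      show "f x = (\<Sum>A\<in>P. scale_fun (f (SOME x. x \<in> A)) (indicator A)) x"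
      proof (cases "x \<in> X")
        case True
        then obtain A where A: "A \<in> P" "x \<in> A"
          using parts(1) by auto
        then have "f x = f (SOME x. x \<in> A)"
          using f someI[of "\<lambda>x. x \<in> A" x] by blast
        then show ?thesis
          using sum_scaled_indicators_apply[OF parts(2) \<open>finite P\<close> A, of "\<lambda>A. f (SOME x. x \<in> A)"]
          by simp
      next
        \<comment> \<open>Outside \<open>X\<close> both sides are zero: \<open>f\<close> by the
          extension-by-zero convention of \<open>L\<close>, the sum because every part lies inside
          \<open>X\<close>.\<close>
        case False
        then have "indicator A x = (0 :: 'f)" if "A \<in> P" for A
          using that parts(1) by (auto simp: indicator_def)
        then show ?thesis
          using f False by (simp add: L_def sum_fun_apply scale_fun_def)
      qed
    qed
    also have "\<dots> \<in> fun_space.span ?B"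
      by (intro fun_space.span_sum fun_space.span_scale fun_space.span_base) auto
    finally show "f \<in> fun_space.span ?B" .
  qed
  moreover have "fun_space.independent ?B"
    using parts \<open>finite P\<close> by (intro independent_indicators) auto
  ultimately have "fun_space.dim ?V = card ?B"
    by (rule fun_space.basis_card_eq_dim[symmetric])
  then show ?thesis
    by (simp add: card_image inj_on_subset[OF inj_indicator])
qed

context group_action
begin

lemma partition_on_orbits: "partition_on E (orbits G E \<phi>)"
proof (rule partition_onI)
  show "disjnt p q" if "p \<in> orbits G E \<phi>" "q \<in> orbits G E \<phi>" "p \<noteq> q" for p q
    using disjoint_union that by (auto simp: disjnt_def)
  show "{} \<notin> orbits G E \<phi>"
    using orbit_refl by (auto simp: orbits_def)
qed (rule orbits_coverture)

text \<open>Every point of the orbit of \<open>x\<close> has the form \<open>\<phi> g x\<close>, so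
  invariance forces the value \<open>f x\<close> on the whole orbit. Conversely, \<open>x\<close>
  and \<open>\<phi> g x\<close> share an orbit.\<close>

lemma L_inv_eq_constant_on_orbits:
  "(L_inv (carrier G) \<phi> E :: ('c \<Rightarrow> 'f::field) set) =
    {f \<in> L E. \<forall>A\<in>orbits G E \<phi>. \<forall>x\<in>A. \<forall>y\<in>A. f x = f y}"
proof (intro Set.set_eqI iffI)
  fix f :: "'c \<Rightarrow> 'f" assume "f \<in> L_inv (carrier G) \<phi> E"
  then show "f \<in> {f \<in> L E. \<forall>A\<in>orbits G E \<phi>. \<forall>x\<in>A. \<forall>y\<in>A. f x = f y}"
    by (auto simp: L_inv_def orbits_def orbit_def)
next
  fix f :: "'c \<Rightarrow> 'f" assume f: "f \<in> {f \<in> L E. \<forall>A\<in>orbits G E \<phi>. \<forall>x\<in>A. \<forall>y\<in>A. f x = f y}"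
  have "f (\<phi> g x) = f x" if "g \<in> carrier G" "x \<in> E" for g x
  proof -
    have "orbit G \<phi> x \<in> orbits G E \<phi>" "\<phi> g x \<in> orbit G \<phi> x" "x \<in> orbit G \<phi> x"
      using that orbit_refl by (auto simp: orbits_def orbit_def)
    with f show ?thesis
      by blast
  qed
  with f show "f \<in> L_inv (carrier G) \<phi> E"
    by (simp add: L_inv_def)
qed

lemma dim_L_inv:
  assumes "finite E"
  shows "fun_space.dim (L_inv (carrier G) \<phi> E :: ('c \<Rightarrow> 'f::field) set) = card (orbits G E \<phi>)"
  unfolding L_inv_eq_constant_on_orbits
  by (rule dim_constant_on_parts[OF partition_on_orbits finite_elements[OF assms partition_on_orbits]])

end

theorem lemma3p1:
  fixes G :: "('g, 'm) monoid_scheme"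
    and X :: "'x set"
    and \<phi> :: "'g \<Rightarrow> 'x \<Rightarrow> 'x"
    and H :: "'g set"
  assumes "group G" and "finite (carrier G)"
    and "group_action G X \<phi>" and "finite X" and "X \<noteq> {}"
    and "subgroup H G"
  shows "rat_of_nat (fun_space.dim (L_inv H \<phi> X :: ('x \<Rightarrow> 'f::field) set))
    = 1 / rat_of_nat (card H) * (\<Sum>a\<in>H. rat_of_nat (card (invariants X \<phi> a)))"
proof -
  \<comment> \<open>Restricting the action makes \<open>H\<close> the full acting group, so the
    results for \<open>carrier G\<close> apply to \<open>H\<close> and its orbits.\<close>
  interpret H: group_action "G\<lparr>carrier := H\<rparr>" X \<phi>
    using assms by (intro group_action.induced_action)
  have "finite H"
    using assms subgroup.subset finite_subset by metis
  moreover have "H \<noteq> {}"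
    using assms subgroup.one_closed by blast
  ultimately have "card H \<noteq> 0"
    by simp
  \<comment> \<open>Burnside's lemma, with the number of \<open>H\<close>-orbits replaced by the
    dimension. It is an identity of natural numbers, so the characteristic of the field does not
    enter; division by \<open>card H\<close> takes place afterwards in the rationals.\<close>
  moreover have "fun_space.dim (L_inv H \<phi> X :: ('x \<Rightarrow> 'f) set) * card H =
      (\<Sum>a\<in>H. card (invariants X \<phi> a))"
    using H.burnside H.dim_L_inv[where 'f = 'f] \<open>finite H\<close> \<open>finite X\<close> by (simp add: order_def)
  then have "rat_of_nat (fun_space.dim (L_inv H \<phi> X :: ('x \<Rightarrow> 'f) set)) * rat_of_nat (card H) =
      (\<Sum>a\<in>H. rat_of_nat (card (invariants X \<phi> a)))"
    by (metis of_nat_mult of_nat_sum)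
  ultimately show ?thesis
    by (simp add: field_simps)
qed

end
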